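(* Let $\mathcal{F}$ be a family of pairs $(f,g)$ of non-negative measurable functions on $\mathbb{R}^n$. Suppose that for some $p_0,\delta$ with $0<p_0<\infty$, $0<\delta<1$, and for every weight $w\in A_1$, $$\int_{\mathbb{R}^n} f(x)^{p_0}\,w(x)^{\delta}\,dx\le C_0\int_{\mathbb{R}^n} g(x)^{p_0}\,w(x)^{\delta}\,dx,\qquad (f,g)\in\mathcal{F}$$ (understood in the sense explained in the context). Let $p:\mathbb{R}^n\to(0,\infty)$ be a measurable function such that $p_0<p^-\le p^+<\frac{p_0}{1-\delta}$ and $\delta\,(p(\cdot)/p_0)'\in\mathcal{B}(\mathbb{R}^n)$. Then there is a constant $C$ such that for all $(f,g)\in\mathcal{F}$ with $f\in L^{p(\cdot)}(\mathbb{R}^n)$, $$\|f\|_{p(\cdot)}\le C\|g\|_{p(\cdot)}.$$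
   Context: For a measurable $p:\mathbb{R}^n\to(0,\infty)$ put $p^-=\operatorname{ess\,inf}_{x}p(x)$, $p^+=\operatorname{ess\,sup}_{x}p(x)$. Variable Lebesgue space: for measurable $p:\mathbb{R}^n\to[1,\infty)$, $L^{p(\cdot)}(\mathbb{R}^n)$ is the set of measurable $f$ such that $\int_{\mathbb{R}^n}(|f(x)|/\lambda)^{p(x)}dx<\infty$ for some $\lambda>0$, with norm $\|f\|_{p(\cdot)}=\inf\{\lambda>0:\int_{\mathbb{R}^n}(|f(x)|/\lambda)^{p(x)}dx\le1\}$. For measurable $p:\mathbb{R}^n\to(0,\infty)$ with $0<p^-\le p^+<\infty$, $L^{p(\cdot)}(\mathbb{R}^n)$ is the set of measurable $f$ with $|f|^{s}\in L^{p(\cdot)/s}(\mathbb{R}^n)$, where $0<s<p^-$, with quasi-norm $\|f\|_{p(\cdot)}=\||f|^{s}\|_{p(\cdot)/s}^{1/s}$ (independent of $s$). A norm is taken to be $+\infty$ if the function is not in the space. Conjugate exponent: $r'(\cdot)$ is defined pointwise by $1/r(x)+1/r'(x)=1$. $\mathcal{B}(\mathbb{R}^n)$ is the set of exponents $r:\mathbb{R}^n\to[1,\infty)$ (measurable) such that the Hardy–Littlewood maximal operator $Mf(x)=\sup_{\rho>0}\frac1{|B(x,\rho)|}\int_{B(x,\rho)}|f(y)|dy$ is bounded on $L^{r(\cdot)}(\mathbb{R}^n)$. A weight is a non-negative locally integrable function $w$ on $\mathbb{R}^n$. $w\in A_1$ means there is a constant $C$ such that for every cube $Q\subset\mathbb{R}^n$,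 $\frac1{|Q|}\int_Q w\,dx\le C\operatorname{ess\,inf}_{x\in Q}w(x)$; the smallest such $C$ is the $A_1$ constant of $w$. Convention: saying that the weighted inequality holds for $(f,g)\in\mathcal{F}$ and $w\in A_1$ means that it holds for any pair in $\mathcal{F}$ for which its left-hand side is finite, with a constant $C_0$ depending only on $p_0$ and the $A_1$ constant of $w$ (here $\delta$ and $\mathcal{F}$ are fixed). *)

theory Defs
  imports "HOL-Probability.Essential_Supremum"
begin

text \<open>
  Measurability and integration refer to Lebesgue measure \<open>lebesgue\<close> on \<open>real ^ 'n\<close>.
  The spaces below see a function only through its modulus, so their elements are
  represented by \<open>ennreal\<close>-valued functions; a real function \<open>f\<close> enters as
  \<open>\<lambda>x. ennreal \<bar>f x\<bar>\<close>.  The value \<open>\<infinity>\<close> is needed because the maximal function may be infinite.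
\<close>

text \<open>Powers on \<open>[0,\<infinity>]\<close>; only meaningful, and only used, for exponents \<open>a > 0\<close>.\<close>

definition epowr :: "ennreal \<Rightarrow> real \<Rightarrow> ennreal" (infixr \<open>epowr\<close> 80)
  where "u epowr a = (if u = \<infinity> then \<infinity> else ennreal (enn2real u powr a))"

text \<open>Companion of the library's \<^const>\<open>esssup\<close>.\<close>

definition essinf :: "'a measure \<Rightarrow> ('a \<Rightarrow> 'b::complete_linorder) \<Rightarrow> 'b"
  where "essinf M f = Sup {z. AE x in M. z \<le> f x}"

definition exponent_minus :: "(real ^ 'n \<Rightarrow> real) \<Rightarrow> ereal"
  where "exponent_minus p = essinf lebesgue (\<lambda>x. ereal (p x))"

definition exponent_plus :: "(real ^ 'n \<Rightarrow> real) \<Rightarrow> ereal"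
  where "exponent_plus p = esssup lebesgue (\<lambda>x. ereal (p x))"

subsection \<open>Variable Lebesgue spaces\<close>

definition modular :: "(real ^ 'n \<Rightarrow> real) \<Rightarrow> (real ^ 'n \<Rightarrow> ennreal) \<Rightarrow> real \<Rightarrow> ennreal"
  where "modular p f l = (\<integral>\<^sup>+x. (f x / ennreal l) epowr p x \<partial>lebesgue)"

text \<open>The space and its norm for exponents with values in \<open>[1,\<infinity>)\<close>.\<close>

definition vLp :: "(real ^ 'n \<Rightarrow> real) \<Rightarrow> (real ^ 'n \<Rightarrow> ennreal) set"
  where "vLp p = {f. f \<in> borel_measurable lebesgue \<and> (\<exists>l>0. modular p f l < \<infinity>)}"

definition vLp_norm :: "(real ^ 'n \<Rightarrow> real) \<Rightarrow> (real ^ 'n \<Rightarrow> ennreal) \<Rightarrow> ennreal"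
  where "vLp_norm p f =
    (if f \<in> vLp p then Inf {ennreal l | l. 0 < l \<and> modular p f l \<le> 1} else \<infinity>)"

text \<open>
  The space and its quasi-norm for exponents with values in \<open>(0,\<infinity>)\<close> and
  \<open>0 < p\<^sup>- \<le> p\<^sup>+ < \<infinity>\<close>, reduced to the previous case through an auxiliary \<open>0 < s < p\<^sup>-\<close>.
  Lemmas \<open>quasi_space_indep\<close> and \<open>quasi_norm_indep\<close> show that the choice of \<open>s\<close> is immaterial.
\<close>

definition vLp_aux :: "(real ^ 'n \<Rightarrow> real) \<Rightarrow> real"
  where "vLp_aux p = (SOME s. 0 < s \<and> ereal s < exponent_minus p)"

definition vLp_quasi :: "(real ^ 'n \<Rightarrow> real) \<Rightarrow> (real ^ 'n \<Rightarrow> ennreal) set"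
  where "vLp_quasi p = {f. f \<in> borel_measurable lebesgue \<and>
    (let s = vLp_aux p in (\<lambda>x. f x epowr s) \<in> vLp (\<lambda>x. p x / s))}"

definition vLp_quasi_norm :: "(real ^ 'n \<Rightarrow> real) \<Rightarrow> (real ^ 'n \<Rightarrow> ennreal) \<Rightarrow> ennreal"
  where "vLp_quasi_norm p f =
    (let s = vLp_aux p in vLp_norm (\<lambda>x. p x / s) (\<lambda>x. f x epowr s) epowr (1 / s))"

subsection \<open>Conjugate exponent, maximal operator, Muckenhoupt weights\<close>

text \<open>
  Solves \<open>1 / r + 1 / r' = 1\<close> whenever \<open>r > 1\<close>.  Where \<open>0 < r \<le> 1\<close> there is no finite
  conjugate exponent \<open>\<ge> 1\<close>, and the value obtained here is \<open>\<le> 0\<close>; so no positive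
  multiple of it takes values in \<open>[1,\<infinity>)\<close>, as membership in \<open>classB\<close> demands.
\<close>

definition conj_exponent :: "('a \<Rightarrow> real) \<Rightarrow> 'a \<Rightarrow> real"
  where "conj_exponent r x = 1 / (1 - 1 / r x)"

definition hl_maximal :: "(real ^ 'n \<Rightarrow> real) \<Rightarrow> real ^ 'n \<Rightarrow> ennreal"
  where "hl_maximal f x = (SUP \<rho>\<in>{0<..}.
    (\<integral>\<^sup>+y\<in>ball x \<rho>. ennreal \<bar>f y\<bar> \<partial>lebesgue) / emeasure lebesgue (ball x \<rho>))"

definition classB :: "(real ^ 'n \<Rightarrow> real) set"
  where "classB = {r. r \<in> borel_measurable lebesgue \<and> (\<forall>x. 1 \<le> r x) \<and>
    (\<exists>C::real. \<forall>f \<in> borel_measurable lebesgue. (\<lambda>x. ennreal \<bar>f x\<bar>) \<in> vLp r \<longrightarrow>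
       vLp_norm r (hl_maximal f) \<le> ennreal C * vLp_norm r (\<lambda>x. ennreal \<bar>f x\<bar>))}"

definition weight :: "(real ^ 'n \<Rightarrow> real) \<Rightarrow> bool"
  where "weight w \<longleftrightarrow> (\<forall>x. 0 \<le> w x) \<and> (\<forall>K. compact K \<longrightarrow> set_integrable lebesgue K w)"

text \<open>Cubes have sides parallel to the coordinate axes.\<close>

definition cubes :: "(real ^ 'n) set set"
  where "cubes = {cbox a (a + (\<chi> i. l)) | a l. 0 < l}"

definition A1_bound :: "(real ^ 'n \<Rightarrow> real) \<Rightarrow> real \<Rightarrow> bool"
  where "A1_bound w C \<longleftrightarrow> 0 \<le> C \<and> (\<forall>Q\<in>cubes.
    (\<integral>\<^sup>+x\<in>Q. ennreal (w x) \<partial>lebesgue) / emeasure lebesgue Q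
      \<le> ennreal C * essinf (restrict_space lebesgue Q) (\<lambda>x. ennreal (w x)))"

definition A1 :: "(real ^ 'n \<Rightarrow> real) set"
  where "A1 = {w. weight w \<and> (\<exists>C. A1_bound w C)}"

definition A1_const :: "(real ^ 'n \<Rightarrow> real) \<Rightarrow> real"
  where "A1_const w = Inf {C. A1_bound w C}"

subsection \<open>Independence of the auxiliary exponent\<close>

lemma epowr_epowr: "0 < a \<Longrightarrow> 0 < b \<Longrightarrow> (u epowr a) epowr b = u epowr (a * b)"
  by (auto simp: epowr_def powr_powr)

lemma epowr_div: "0 < l \<Longrightarrow> (u / ennreal l) epowr a = u epowr a / ennreal (l powr a)"
  by (cases u) (auto simp: epowr_def divide_ennreal powr_divide ennreal_top_divide
      ennreal_divide_eq_top_iff)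

lemma modular_epowr:
  assumes p: "\<And>x. 0 < p x" and s: "0 < s" and l: "0 < l"
  shows "modular (\<lambda>x. p x / s) (\<lambda>x. f x epowr s) (l powr s) = modular p f l"
proof -
  have "((f x epowr s) / ennreal (l powr s)) epowr (p x / s) = (f x / ennreal l) epowr p x" for x
    using p[of x] s l by (simp add: epowr_div[symmetric] epowr_epowr)
  then show ?thesis by (simp add: modular_def)
qed

lemma epowr_mono: "0 < a \<Longrightarrow> u \<le> v \<Longrightarrow> u epowr a \<le> v epowr a"
  by (cases u; cases v) (auto simp: epowr_def top_unique intro!: ennreal_leI powr_mono2)

lemma epowr_measurable:
  assumes [measurable]: "f \<in> borel_measurable M"
  shows "(\<lambda>x. f x epowr a) \<in> borel_measurable M"
  unfolding epowr_def by measurable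

lemma epowr_1 [simp]: "u epowr 1 = u"
  by (cases u) (auto simp: epowr_def)

lemma epowr_ennreal: "0 \<le> l \<Longrightarrow> ennreal l epowr a = ennreal (l powr a)"
  by (simp add: epowr_def)

lemma quasi_space_indep:
  assumes p: "\<And>x. 0 < p x" and s: "0 < s" and f: "f \<in> borel_measurable lebesgue"
  shows "(\<lambda>x. f x epowr s) \<in> vLp (\<lambda>x. p x / s) \<longleftrightarrow> f \<in> vLp p"
proof
  assume "(\<lambda>x. f x epowr s) \<in> vLp (\<lambda>x. p x / s)"
  then obtain l where l: "0 < l" "modular (\<lambda>x. p x / s) (\<lambda>x. f x epowr s) l < \<infinity>"
    by (auto simp: vLp_def)
  have "modular p f (l powr (1 / s)) < \<infinity>"
    using l s modular_epowr[of p s "l powr (1 / s)" f, OF p] by (simp add: powr_powr)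
  with l f show "f \<in> vLp p"
    unfolding vLp_def by (auto intro!: exI[of _ "l powr (1 / s)"])
next
  assume "f \<in> vLp p"
  then obtain l where l: "0 < l" "modular p f l < \<infinity>"
    by (auto simp: vLp_def)
  with f s show "(\<lambda>x. f x epowr s) \<in> vLp (\<lambda>x. p x / s)"
    unfolding vLp_def
    by (auto intro!: exI[of _ "l powr s"] epowr_measurable simp: modular_epowr[OF p])
qed

lemma quasi_norm_indep:
  assumes p: "\<And>x. 0 < p x" and s: "0 < s" and f: "f \<in> borel_measurable lebesgue"
  shows "vLp_norm (\<lambda>x. p x / s) (\<lambda>x. f x epowr s) epowr (1 / s) = vLp_norm p f"
proof (cases "f \<in> vLp p")
  case False
  then show ?thesis using quasi_space_indep[OF p s f] by (simp add: vLp_norm_def epowr_def)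
next
  case True
  let ?A = "{ennreal l | l. 0 < l \<and> modular (\<lambda>x. p x / s) (\<lambda>x. f x epowr s) l \<le> 1}"
  let ?B = "{ennreal l | l. 0 < l \<and> modular p f l \<le> 1}"
  have "Inf ?A epowr (1 / s) \<le> Inf ?B"
  proof (rule Inf_greatest, clarify)
    fix l :: real assume l: "0 < l" "modular p f l \<le> 1"
    have "modular (\<lambda>x. p x / s) (\<lambda>x. f x epowr s) (l powr s) \<le> 1"
      using l s by (simp add: modular_epowr[OF p])
    with l have "Inf ?A \<le> ennreal (l powr s)"
      by (intro Inf_lower) auto
    then have "Inf ?A epowr (1 / s) \<le> ennreal (l powr s) epowr (1 / s)"
      using s by (intro epowr_mono) auto
    also have "\<dots> = ennreal l"
      using s l by (simp add: epowr_ennreal powr_powr)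
    finally show "Inf ?A epowr (1 / s) \<le> ennreal l" .
  qed
  moreover have "Inf ?B epowr s \<le> Inf ?A"
  proof (rule Inf_greatest, clarify)
    fix l :: real assume l: "0 < l" "modular (\<lambda>x. p x / s) (\<lambda>x. f x epowr s) l \<le> 1"
    have "modular p f (l powr (1 / s)) \<le> 1"
      using l s modular_epowr[of p s "l powr (1 / s)" f, OF p] by (simp add: powr_powr)
    with l have "Inf ?B \<le> ennreal (l powr (1 / s))"
      by (intro Inf_lower) auto
    then have "Inf ?B epowr s \<le> ennreal (l powr (1 / s)) epowr s"
      using s by (intro epowr_mono) auto
    also have "\<dots> = ennreal l"
      using s l by (simp add: epowr_ennreal powr_powr)
    finally show "Inf ?B epowr s \<le> ennreal l" .
  qed
  then have "(Inf ?B epowr s) epowr (1 / s) \<le> Inf ?A epowr (1 / s)"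
    using s by (intro epowr_mono) auto
  then have "Inf ?B \<le> Inf ?A epowr (1 / s)"
    using s by (simp add: epowr_epowr)
  ultimately show ?thesis
    using True quasi_space_indep[OF p s f] by (simp add: vLp_norm_def)
qed

end

theory Submission
  imports Defs
begin

text \<open>
  Write \<open>r = \<delta> (p/p\<^sub>0)' = \<delta> p / (p - p\<^sub>0)\<close>.  The function \<open>u = (f/L) powr ((p - p\<^sub>0)/\<delta>)\<close> satisfies
  \<open>u powr r = (f/L) powr p = (f/L) powr p\<^sub>0 * u powr \<delta>\<close>.
  The Rubio de Francia iteration of \<open>M\<close> on \<open>L\<^sup>r\<close> majorizes \<open>u\<close> by an \<open>A\<^sub>1\<close> weight \<open>w\<close>, so the
  weighted inequality for \<open>w\<close> and Young's inequality bound the modular of \<open>f\<close> by that of \<open>g\<close>.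

  The constant \<open>C\<^sub>0\<close> is an arbitrary function of the \<open>A\<^sub>1\<close> constant, possibly unbounded on
  bounded sets, so different weights cannot be used for different pairs.  Instead, if the
  conclusion failed, there would be a sequence of pairs violating it with constants whose
  \<open>p\<^sub>0\<close>-th powers are \<open>8 ^ k\<close>; a single weight that majorizes all the functions \<open>u\<^sub>k\<close> up to factors
  \<open>4 ^ (k + 2)\<close> then gives a contradiction.
\<close>

declare power_Suc [simp del]

section \<open>The unit ball of the modular, its series and its maximal functions\<close>

text \<open>Fixing the scale 1 turns both the boundedness of M and the convergence of series into
  closure properties of a single set, in place of estimates for the norm.\<close>

definition modular_ball :: "(real ^ 'n \<Rightarrow> real) \<Rightarrow> (real ^ 'n \<Rightarrow> real) set"
  where "modular_ball r = {u \<in> borel_measurable lebesgue.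
    (\<forall>x. 0 \<le> u x) \<and> (\<integral>\<^sup>+x. ennreal (u x powr r x) \<partial>lebesgue) \<le> 1}"

lemma modular_ball_measurable [measurable_dest]:
  "u \<in> modular_ball r \<Longrightarrow> u \<in> borel_measurable lebesgue"
  by (simp add: modular_ball_def)

lemma modular_ball_nonneg: "u \<in> modular_ball r \<Longrightarrow> 0 \<le> u x"
  by (simp add: modular_ball_def)

lemma modular_ball_integral:
  "u \<in> modular_ball r \<Longrightarrow> (\<integral>\<^sup>+x. ennreal (u x powr r x) \<partial>lebesgue) \<le> 1"
  by (simp add: modular_ball_def)

lemma suminf_ennreal_half_powers: "(\<Sum>k. ennreal (1 / 2 ^ Suc k)) = 1"
proof -
  have "(\<lambda>k. (1 / 2 :: real) ^ Suc k) sums 1"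
    using power_half_series by simp
  then show ?thesis
    by (subst suminf_ennreal_eq[of _ 1]) (auto simp: power_divide)
qed

lemma ennreal_le_suminf: "f k \<le> suminf f" for f :: "nat \<Rightarrow> ennreal"
  using sum_le_suminf[of f "{k}"] by simp

lemma ennreal_suminf_Suc_le: "(\<Sum>k. f (Suc k)) \<le> suminf f" for f :: "nat \<Rightarrow> ennreal"
  using suminf_offset[of f 1, OF summableI] by simp

text \<open>A termwise substitute for Jensen's inequality. The factor 1/4^(k+1) splits into two
  factors 1/2^(k+1). Since \<open>r\<close> is at least 1, dividing \<open>a k\<close> by 2^(k+1)
  divides its r-th power by at least 2^(k+1), so the quotient is at most the r-th root of the
  right-hand sum; the second factors sum to 1.\<close>

lemma powr_suminf_le:
  fixes a :: "nat \<Rightarrow> real"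
  assumes a: "\<And>k. 0 \<le> a k" and r: "1 \<le> r"
  shows "(\<Sum>k. ennreal (a k / 4 ^ Suc k)) epowr r \<le> (\<Sum>k. ennreal (a k powr r / 2 ^ Suc k))"
    (is "?V epowr r \<le> ?Y")
proof (cases "?Y = \<infinity>")
  case False
  define y where "y = enn2real ?Y"
  have y: "?Y = ennreal y" "0 \<le> y"
    using False by (auto simp: y_def less_top)
  have "a k / 2 ^ Suc k \<le> y powr (1 / r)" for k
  proof -
    have "ennreal (a k powr r / 2 ^ Suc k) \<le> ?Y"
      by (rule ennreal_le_suminf)
    then have "a k powr r / 2 ^ Suc k \<le> y"
      unfolding y(1) using y(2) by simp
    moreover have "(2::real) ^ Suc k \<le> (2 ^ Suc k) powr r"
      using powr_mono[of 1 r "2 ^ Suc k :: real"] r by simp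
    then have "a k powr r / (2 ^ Suc k) powr r \<le> a k powr r / 2 ^ Suc k"
      by (intro divide_left_mono) auto
    ultimately have "(a k / 2 ^ Suc k) powr r \<le> y"
      using a[of k] by (simp add: powr_divide del: power_Suc)
    then have "((a k / 2 ^ Suc k) powr r) powr (1 / r) \<le> y powr (1 / r)"
      using r by (intro powr_mono2) auto
    then show ?thesis
      using a[of k] r by (simp add: powr_powr del: power_Suc)
  qed
  then have "a k / 4 ^ Suc k \<le> y powr (1 / r) * (1 / 2 ^ Suc k)" for k
  proof -
    have "a k / 4 ^ Suc k = a k / 2 ^ Suc k * (1 / 2 ^ Suc k)"
      by (simp add: power_mult_distrib[symmetric])
    also have "\<dots> \<le> y powr (1 / r) * (1 / 2 ^ Suc k)"
      using \<open>\<And>k. a k / 2 ^ Suc k \<le> y powr (1 / r)\<close>[of k] by (intro mult_right_mono) auto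
    finally show ?thesis .
  qed
  then have "?V \<le> (\<Sum>k. ennreal (y powr (1 / r)) * ennreal (1 / 2 ^ Suc k))"
    by (intro suminf_le) (auto simp: ennreal_mult'[symmetric] intro!: ennreal_leI)
  also have "\<dots> = ennreal (y powr (1 / r))"
    using suminf_ennreal_half_powers by (simp add: ennreal_suminf_cmult del: power_Suc)
  finally have "?V epowr r \<le> ennreal (y powr (1 / r)) epowr r"
    using r by (intro epowr_mono) auto
  also have "\<dots> = ?Y"
    using r y by (simp add: epowr_ennreal powr_powr)
  finally show ?thesis .
qed simp

text \<open>Integrating \<open>powr_suminf_le\<close> leaves modulars with weights 1/2^(k+1), whose
  total is 1, so the ball absorbs such series without loss. Where the series diverges, on a null
  set, \<open>enn2real\<close> gives 0.\<close>

lemma modular_ball_suminf: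
  fixes u :: "nat \<Rightarrow> real ^ 'n \<Rightarrow> real"
  assumes u: "\<And>k. u k \<in> modular_ball r"
    and [measurable]: "r \<in> borel_measurable lebesgue" and r: "\<And>x. 1 \<le> r x"
  defines "V \<equiv> \<lambda>x. \<Sum>k. ennreal (u k x / 4 ^ Suc k)"
  shows "AE x in lebesgue. V x < \<infinity>" and "(\<lambda>x. enn2real (V x)) \<in> modular_ball r"
proof -
  note [measurable] = modular_ball_measurable[OF u]
  have [measurable]: "V \<in> borel_measurable lebesgue"
    unfolding V_def by measurable
  define Y where "Y = (\<lambda>x. \<Sum>k. ennreal (u k x powr r x / 2 ^ Suc k))"
  have [measurable]: "Y \<in> borel_measurable lebesgue"
    unfolding Y_def by measurable
  have VY: "V x epowr r x \<le> Y x" for x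
    unfolding V_def Y_def by (rule powr_suminf_le) (use r modular_ball_nonneg[OF u] in auto)
  have "(\<integral>\<^sup>+x. Y x \<partial>lebesgue) = (\<Sum>k. \<integral>\<^sup>+x. ennreal (1 / 2 ^ Suc k) * ennreal (u k x powr r x) \<partial>lebesgue)"
    unfolding Y_def
    by (subst nn_integral_suminf) (auto simp: ennreal_mult'[symmetric])
  also have "\<dots> = (\<Sum>k. ennreal (1 / 2 ^ Suc k) * (\<integral>\<^sup>+x. ennreal (u k x powr r x) \<partial>lebesgue))"
    by (subst nn_integral_cmult) (auto)
  also have "\<dots> \<le> (\<Sum>k. ennreal (1 / 2 ^ Suc k) * 1)"
    using u by (intro suminf_le mult_left_mono) (auto simp: modular_ball_integral)
  also have "\<dots> = 1"
    using suminf_ennreal_half_powers by simp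
  finally have Y: "(\<integral>\<^sup>+x. Y x \<partial>lebesgue) \<le> 1" .
  then have "AE x in lebesgue. Y x \<noteq> \<infinity>"
    by (intro nn_integral_PInf_AE) (auto simp: top_unique)
  then show "AE x in lebesgue. V x < \<infinity>"
  proof eventually_elim
    case (elim x)
    with VY[of x] show ?case by (cases "V x") (auto simp: epowr_def top_unique)
  qed
  have "(\<integral>\<^sup>+x. ennreal (enn2real (V x) powr r x) \<partial>lebesgue) \<le> (\<integral>\<^sup>+x. Y x \<partial>lebesgue)"
  proof (rule nn_integral_mono)
    fix x
    have "ennreal (enn2real (V x) powr r x) \<le> V x epowr r x"
      by (auto simp: epowr_def)
    with VY[of x] show "ennreal (enn2real (V x) powr r x) \<le> Y x" by (rule order_trans[rotated])
  qed
  with Y show "(\<lambda>x. enn2real (V x)) \<in> modular_ball r"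
    by (auto simp: modular_ball_def)
qed

text \<open>For \<open>u\<close> in the ball the norm of M u is at most \<open>ennreal C\<close>. A
  \<open>D\<close> strictly above this leaves room for a scale \<open>l < D\<close> at which the
  modular is at most 1, so the infimum in the norm need not be attained.\<close>

lemma classB_modular_ball:
  fixes r :: "real ^ 'n \<Rightarrow> real"
  assumes "r \<in> classB"
  obtains D :: real where "0 < D"
    and "\<And>u. u \<in> modular_ball r \<Longrightarrow> AE x in lebesgue. hl_maximal u x < \<infinity>"
    and "\<And>u. u \<in> modular_ball r \<Longrightarrow> (\<lambda>x. enn2real (hl_maximal u x) / D) \<in> modular_ball r"
proof -
  from assms have [measurable]: "r \<in> borel_measurable lebesgue" and r: "\<And>x. 1 \<le> r x"
    by (auto simp: classB_def)
  from assms obtain C :: real where C: "\<And>f. f \<in> borel_measurable lebesgue \<Longrightarrow>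
      (\<lambda>x. ennreal \<bar>f x\<bar>) \<in> vLp r \<Longrightarrow>
      vLp_norm r (hl_maximal f) \<le> ennreal C * vLp_norm r (\<lambda>x. ennreal \<bar>f x\<bar>)"
    unfolding classB_def by blast
  define D where "D = max C 0 + 1"
  have D: "0 < D" "ennreal C < ennreal D"
    unfolding D_def by (simp, intro ennreal_lessI) (auto simp: max_def)
  have main: "(\<lambda>x. hl_maximal u x) \<in> borel_measurable lebesgue \<and>
      (\<integral>\<^sup>+x. (hl_maximal u x / ennreal D) epowr r x \<partial>lebesgue) \<le> 1"
    if u: "u \<in> modular_ball r" for u
  proof -
    note [measurable] = modular_ball_measurable[OF u]
    have m: "modular r (\<lambda>x. ennreal \<bar>u x\<bar>) 1 \<le> 1"
      using modular_ball_integral[OF u] by (simp add: modular_def epowr_ennreal modular_ball_nonneg[OF u] divide_ennreal flip: ennreal_1)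
    then have uL: "(\<lambda>x. ennreal \<bar>u x\<bar>) \<in> vLp r"
      unfolding vLp_def by (auto intro!: exI[of _ 1] simp: less_top[symmetric] top_unique)
    have "vLp_norm r (\<lambda>x. ennreal \<bar>u x\<bar>) \<le> ennreal 1"
      unfolding vLp_norm_def using uL m by (auto intro!: Inf_lower exI[of _ 1] simp del: ennreal_1)
    then have "ennreal C * vLp_norm r (\<lambda>x. ennreal \<bar>u x\<bar>) \<le> ennreal C * 1"
      by (intro mult_left_mono) auto
    with C[of u] uL D have less: "vLp_norm r (hl_maximal u) < ennreal D"
      by (auto intro: le_less_trans)
    \<comment> \<open>The norm is infinite off the space, so its finiteness also supplies the
      measurability of the maximal function.\<close>
    then have L: "hl_maximal u \<in> vLp r"
      by (auto simp: vLp_norm_def split: if_splits)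
    with less obtain l where l: "0 < l" "modular r (hl_maximal u) l \<le> 1" "ennreal l < ennreal D"
      by (auto simp: vLp_norm_def Inf_less_iff)
    have "hl_maximal u x / ennreal D \<le> hl_maximal u x / ennreal l" for x
      using l D by (cases "hl_maximal u x")
        (auto simp: divide_ennreal ennreal_top_divide ennreal_less_iff intro!: ennreal_leI divide_left_mono)
    moreover have "0 < r x" for x
      using r[of x] by simp
    ultimately have "(\<integral>\<^sup>+x. (hl_maximal u x / ennreal D) epowr r x \<partial>lebesgue) \<le> modular r (hl_maximal u) l"
      unfolding modular_def by (intro nn_integral_mono epowr_mono)
    with l L show ?thesis by (auto simp: vLp_def)
  qed
  show thesis
  proof
    show "0 < D" by fact
  next
    fix u assume u: "u \<in> modular_ball r"
    have [measurable]: "hl_maximal u \<in> borel_measurable lebesgue"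
      using main[OF u] by simp
    have [measurable]: "(\<lambda>x. (hl_maximal u x / ennreal D) epowr r x) \<in> borel_measurable lebesgue"
      unfolding epowr_def by measurable
    have "AE x in lebesgue. (hl_maximal u x / ennreal D) epowr r x \<noteq> \<infinity>"
      using main[OF u] by (intro nn_integral_PInf_AE) (auto simp: top_unique)
    then show "AE x in lebesgue. hl_maximal u x < \<infinity>"
    proof eventually_elim
      case (elim x)
      with D show ?case
        by (auto simp: epowr_def less_top ennreal_divide_eq_top_iff ennreal_top_divide split: if_splits)
    qed
    have "(\<integral>\<^sup>+x. ennreal ((enn2real (hl_maximal u x) / D) powr r x) \<partial>lebesgue)
        \<le> (\<integral>\<^sup>+x. (hl_maximal u x / ennreal D) epowr r x \<partial>lebesgue)"
    proof (rule nn_integral_mono)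
      fix x
      show "ennreal ((enn2real (hl_maximal u x) / D) powr r x) \<le> (hl_maximal u x / ennreal D) epowr r x"
        using D by (cases "hl_maximal u x") (auto simp: epowr_def divide_ennreal)
    qed
    with main[OF u] D show "(\<lambda>x. enn2real (hl_maximal u x) / D) \<in> modular_ball r"
      by (auto simp: modular_ball_def)
  qed
qed


section \<open>Cubes, maximal averages and A_1 weights\<close>

lemma emeasure_lebesgue_cube:
  fixes a :: "real ^ 'n"
  assumes "0 \<le> l"
  shows "emeasure lebesgue (cbox a (a + (\<chi> i. l))) = ennreal (l ^ CARD('n))"
proof -
  have "cbox a (a + (\<chi> i. l)) \<noteq> {}"
    using assms by (auto simp: interval_ne_empty_cart)
  then have "measure lebesgue (cbox a (a + (\<chi> i. l))) = l ^ CARD('n)"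
    by (simp add: content_cbox_cart measure_completion)
  moreover have "emeasure lebesgue (cbox a (a + (\<chi> i. l))) = ennreal (measure lebesgue (cbox a (a + (\<chi> i. l))))"
    by (intro emeasure_eq_measure2) auto
  ultimately show ?thesis by simp
qed

text \<open>With n the dimension, the cube sits in a ball of radius (n+1)l centred at
  \<open>x\<close>, and this ball in a cube of side 2(n+1)l. Comparing the volumes of the two cubes
  gives the factor (2(n+1))^n.\<close>

lemma cube_average_le_hl_maximal:
  fixes a x :: "real ^ 'n"
  assumes l: "0 < l" and x: "x \<in> cbox a (a + (\<chi> i. l))" (is "x \<in> ?Q")
  shows "(\<integral>\<^sup>+y\<in>?Q. ennreal \<bar>f y\<bar> \<partial>lebesgue) / emeasure lebesgue ?Q
    \<le> ennreal ((2 * (real CARD('n) + 1)) ^ CARD('n)) * hl_maximal f x"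
proof -
  define n where "n = CARD('n)"
  \<comment> \<open>The l1 norm bounds the distance of two points of the cube by n l; the additional
    l gives the strict inequality that the open ball requires.\<close>
  define \<rho> where "\<rho> = (real n + 1) * l"
  define b where "b = measure lebesgue (ball x \<rho>)"
  have \<rho>: "0 < \<rho>" using l by (simp add: \<rho>_def)
  have b: "emeasure lebesgue (ball x \<rho>) = ennreal b"
    unfolding b_def by (intro emeasure_eq_measure2) auto
  have "?Q \<subseteq> ball x \<rho>"
  proof
    fix y assume y: "y \<in> ?Q"
    have "norm (x - y) \<le> (\<Sum>i\<in>UNIV. \<bar>(x - y) $ i\<bar>)"
      by (rule norm_le_l1_cart)
    also have "\<dots> \<le> (\<Sum>i\<in>(UNIV::'n set). l)"
    proof (rule sum_mono)
      fix i
      have "a $ i \<le> x $ i" "x $ i \<le> a $ i + l" "a $ i \<le> y $ i" "y $ i \<le> a $ i + l"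
        using x y by (auto simp: mem_box_cart)
      then show "\<bar>(x - y) $ i\<bar> \<le> l" by (simp add: abs_le_iff)
    qed
    also have "\<dots> < \<rho>" using l by (simp add: \<rho>_def n_def algebra_simps)
    finally show "y \<in> ball x \<rho>" by (simp add: dist_norm)
  qed
  then have "(\<integral>\<^sup>+y\<in>?Q. ennreal \<bar>f y\<bar> \<partial>lebesgue) \<le> (\<integral>\<^sup>+y\<in>ball x \<rho>. ennreal \<bar>f y\<bar> \<partial>lebesgue)" (is "_ \<le> ?I")
    by (intro nn_integral_mono) (auto simp: indicator_def)
  then have "(\<integral>\<^sup>+y\<in>?Q. ennreal \<bar>f y\<bar> \<partial>lebesgue) / emeasure lebesgue ?Q \<le> ?I / ennreal (l ^ n)"
    unfolding emeasure_lebesgue_cube[OF less_imp_le[OF l]] n_def by (rule divide_right_mono_ennreal)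
  also have "\<dots> \<le> ennreal ((2 * (real n + 1)) ^ n) * (?I / ennreal b)"
  proof -
    have "ball x \<rho> \<subseteq> cbox (x - (\<chi> i. \<rho>)) (x - (\<chi> i. \<rho>) + (\<chi> i. 2 * \<rho>))"
    proof
      fix y assume "y \<in> ball x \<rho>"
      then have "\<bar>(x - y) $ i\<bar> < \<rho>" for i
        using component_le_norm_cart[of "x - y" i] by (simp add: dist_norm)
      then show "y \<in> cbox (x - (\<chi> i. \<rho>)) (x - (\<chi> i. \<rho>) + (\<chi> i. 2 * \<rho>))"
        by (auto simp: mem_box_cart abs_less_iff algebra_simps less_imp_le)
    qed
    then have "emeasure lebesgue (ball x \<rho>) \<le> ennreal ((2 * \<rho>) ^ n)"
      using \<rho> emeasure_lebesgue_cube[of "2 * \<rho>" "x - (\<chi> i. \<rho>)"]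
        emeasure_mono[of "ball x \<rho>" "cbox (x - (\<chi> i. \<rho>)) (x - (\<chi> i. \<rho>) + (\<chi> i. 2 * \<rho>))" lebesgue]
      by (simp add: n_def)
    then have b_le: "b \<le> (2 * (real n + 1)) ^ n * l ^ n"
    proof -
      have "(2 * \<rho>) ^ n = (2 * (real n + 1)) ^ n * l ^ n"
        unfolding \<rho>_def power_mult_distrib[symmetric] by (simp only: mult.assoc)
      moreover have "b \<le> (2 * \<rho>) ^ n"
        using \<open>emeasure lebesgue (ball x \<rho>) \<le> ennreal ((2 * \<rho>) ^ n)\<close> \<rho> unfolding b by simp
      ultimately show ?thesis by simp
    qed
    have "0 < b"
      using \<rho> content_ball_pos[of \<rho> x] by (simp add: b_def measure_completion)
    show ?thesis
    proof (cases ?I)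
      case (real v)
      have "v / l ^ n \<le> (2 * (real n + 1)) ^ n * (v / b)"
        using mult_left_mono[OF b_le \<open>0 \<le> v\<close>] l \<open>0 < b\<close> by (simp add: field_simps)
      with real l \<open>0 < b\<close> show ?thesis
        by (simp add: divide_ennreal ennreal_mult'[symmetric] ennreal_leI)
    next
      case top
      then show ?thesis
        by (simp add: ennreal_top_divide ennreal_mult_eq_top_iff)
    qed
  qed
  also have "?I / ennreal b \<le> hl_maximal f x"
    unfolding hl_maximal_def b[symmetric] using \<rho> by (intro SUP_upper) auto
  finally show ?thesis
    by (simp add: n_def mult_left_mono)
qed

text \<open>For almost every x in a cube the average is at most c M w(x), hence at most c K w(x).
  The average divided by the constant is thus one of the lower bounds over which
  \<open>essinf\<close> takes its supremum.\<close>

lemma A1_if_hl_maximal_le: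
  fixes w :: "real ^ 'n \<Rightarrow> real"
  assumes w: "weight w" and K: "0 \<le> K"
    and M: "AE x in lebesgue. hl_maximal w x \<le> ennreal (K * w x)"
  shows "w \<in> A1"
proof -
  define c where "c = (2 * (real CARD('n) + 1)) ^ CARD('n)"
  have c: "0 < c" by (simp add: c_def)
  have w0: "0 \<le> w x" for x using w by (simp add: weight_def)
  have "(\<integral>\<^sup>+x\<in>Q. ennreal (w x) \<partial>lebesgue) / emeasure lebesgue Q
      \<le> ennreal (c * (K + 1)) * essinf (restrict_space lebesgue Q) (\<lambda>x. ennreal (w x))" (is "?A \<le> _")
    if "Q \<in> cubes" for Q :: "(real ^ 'n) set"
  proof -
    from that obtain a l where Q: "Q = cbox a (a + (\<chi> i. l))" and l: "0 < l"
      by (auto simp: cubes_def)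
    \<comment> \<open>\<open>K + 1\<close> in place of \<open>K\<close> keeps the divisor
      positive.\<close>
    have "AE x in restrict_space lebesgue Q. ?A / ennreal (c * (K + 1)) \<le> ennreal (w x)"
    proof (subst AE_restrict_space_iff)
      show "AE x in lebesgue. x \<in> Q \<longrightarrow> ?A / ennreal (c * (K + 1)) \<le> ennreal (w x)"
        using M
      proof eventually_elim
        case (elim x)
        show ?case
        proof
          assume "x \<in> Q"
          then have "?A \<le> ennreal c * hl_maximal w x"
            using cube_average_le_hl_maximal[OF l, of x a w] w0 by (simp add: Q c_def)
          also have "\<dots> \<le> ennreal c * ennreal (K * w x)"
            using elim by (rule mult_left_mono) simp
          also have "\<dots> \<le> ennreal (c * (K + 1)) * ennreal (w x)"
            using c K w0[of x] by (simp add: ennreal_mult'[symmetric] ennreal_leI algebra_simps)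
          finally show "?A / ennreal (c * (K + 1)) \<le> ennreal (w x)"
            using c K by (intro divide_le_posI_ennreal[of "ennreal _"]) (auto simp: mult.commute)
        qed
      qed
    qed (simp add: Q)
    then have "?A / ennreal (c * (K + 1)) \<le> essinf (restrict_space lebesgue Q) (\<lambda>x. ennreal (w x))"
      unfolding essinf_def by (intro Sup_upper) simp
    then have "ennreal (c * (K + 1)) * (?A / ennreal (c * (K + 1)))
        \<le> ennreal (c * (K + 1)) * essinf (restrict_space lebesgue Q) (\<lambda>x. ennreal (w x))"
      by (rule mult_left_mono) simp
    moreover have "ennreal (c * (K + 1)) * (?A / ennreal (c * (K + 1))) = ?A"
    proof -
      have "t * (z / t) = z" if "t \<noteq> 0" "t \<noteq> top" for t z :: ennreal
        using that by (simp add: ennreal_times_divide mult.commute[of t] mult_divide_eq_ennreal)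
      moreover have "ennreal (c * (K + 1)) \<noteq> 0"
        using c K by (simp add: ennreal_eq_0_iff not_le)
      ultimately show ?thesis by simp
    qed
    ultimately show ?thesis by simp
  qed
  then have "A1_bound w (c * (K + 1))"
    using c K by (simp add: A1_bound_def)
  with w show ?thesis by (auto simp: A1_def)
qed

text \<open>As \<open>r\<close> is at least 1, w <= 1 + w^r pointwise, and both terms have finite
  integral over a compact set.\<close>

lemma weight_if_modular_ball:
  fixes r :: "real ^ 'n \<Rightarrow> real"
  assumes w: "w \<in> modular_ball r" and [measurable]: "r \<in> borel_measurable lebesgue" and r: "\<And>x. 1 \<le> r x"
  shows "weight w"
  unfolding weight_def
proof (intro conjI allI impI)
  show "0 \<le> w x" for x using w by (rule modular_ball_nonneg)
  fix K :: "(real ^ 'n) set" assume K: "compact K"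
  note [measurable] = modular_ball_measurable[OF w]
  have [measurable]: "K \<in> sets lebesgue" using lmeasurable_compact[OF K] by auto
  have "w x \<le> 1 + w x powr r x" for x
    using powr_mono[of 1 "r x" "w x"] r[of x] modular_ball_nonneg[OF w, of x]
    by (cases "1 \<le> w x") (auto intro: add_increasing2)
  then have "(\<integral>\<^sup>+x. ennreal (norm (indicat_real K x *\<^sub>R w x)) \<partial>lebesgue)
      \<le> (\<integral>\<^sup>+x. indicator K x + ennreal (w x powr r x) \<partial>lebesgue)"
    by (intro nn_integral_mono)
      (auto simp: indicator_def modular_ball_nonneg[OF w] ennreal_plus[symmetric] ennreal_1[symmetric]
        simp del: ennreal_plus ennreal_1 intro!: ennreal_leI)
  also have "\<dots> = emeasure lebesgue K + (\<integral>\<^sup>+x. ennreal (w x powr r x) \<partial>lebesgue)"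
    by (subst nn_integral_add) auto
  also have "\<dots> < \<infinity>"
    using modular_ball_integral[OF w] lmeasurable_compact[OF K]
    by (auto simp: fmeasurable_def intro: le_less_trans)
  finally show "set_integrable lebesgue K w"
    unfolding set_integrable_def by (intro integrableI_bounded) auto
qed

section \<open>Rubio de Francia iteration and a common majorant\<close>

text \<open>Monotone convergence moves the sum out of each ball average, and every term is then
  bounded by its own supremum over radii. \<open>enn2real\<close> can only lower the left side, so
  the series may diverge.\<close>

lemma hl_maximal_suminf_le:
  fixes u :: "nat \<Rightarrow> real ^ 'n \<Rightarrow> real"
  assumes [measurable]: "\<And>k. u k \<in> borel_measurable lebesgue"
    and u: "\<And>k x. 0 \<le> u k x" and c: "\<And>k. 0 \<le> c k"
  shows "hl_maximal (\<lambda>x. enn2real (\<Sum>k. ennreal (c k * u k x))) x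
    \<le> (\<Sum>k. ennreal (c k) * hl_maximal (u k) x)"
  unfolding hl_maximal_def[of "\<lambda>x. enn2real (\<Sum>k. ennreal (c k * u k x))"]
proof (rule SUP_least)
  fix \<rho> :: real assume \<rho>: "\<rho> \<in> {0<..}"
  have [measurable]: "ball x \<rho> \<in> sets lebesgue" by simp
  have "(\<integral>\<^sup>+y\<in>ball x \<rho>. ennreal \<bar>enn2real (\<Sum>k. ennreal (c k * u k y))\<bar> \<partial>lebesgue)
      \<le> (\<integral>\<^sup>+y. (\<Sum>k. ennreal (c k) * (ennreal \<bar>u k y\<bar> * indicator (ball x \<rho>) y)) \<partial>lebesgue)"
    using c u by (intro nn_integral_mono) (auto simp: indicator_def ennreal_enn2real_if ennreal_mult')
  also have "\<dots> = (\<Sum>k. ennreal (c k) * (\<integral>\<^sup>+y\<in>ball x \<rho>. ennreal \<bar>u k y\<bar> \<partial>lebesgue))"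
    by (subst nn_integral_suminf) (auto simp: nn_integral_cmult)
  finally have "(\<integral>\<^sup>+y\<in>ball x \<rho>. ennreal \<bar>enn2real (\<Sum>k. ennreal (c k * u k y))\<bar> \<partial>lebesgue)
      / emeasure lebesgue (ball x \<rho>)
      \<le> (\<Sum>k. ennreal (c k) * (\<integral>\<^sup>+y\<in>ball x \<rho>. ennreal \<bar>u k y\<bar> \<partial>lebesgue)) / emeasure lebesgue (ball x \<rho>)"
    by (rule divide_right_mono_ennreal)
  also have "\<dots> = (\<Sum>k. ennreal (c k) * ((\<integral>\<^sup>+y\<in>ball x \<rho>. ennreal \<bar>u k y\<bar> \<partial>lebesgue) / emeasure lebesgue (ball x \<rho>)))"
    by (simp only: ennreal_times_divide ennreal_suminf_divide)
  also have "\<dots> \<le> (\<Sum>k. ennreal (c k) * hl_maximal (u k) x)"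
    unfolding hl_maximal_def using \<rho> by (intro suminf_le mult_left_mono SUP_upper) auto
  finally show "(\<integral>\<^sup>+y\<in>ball x \<rho>. ennreal \<bar>enn2real (\<Sum>k. ennreal (c k * u k y))\<bar> \<partial>lebesgue)
      / emeasure lebesgue (ball x \<rho>) \<le> (\<Sum>k. ennreal (c k) * hl_maximal (u k) x)" .
qed

text \<open>The iterates \<open>U k\<close> of M/D stay in the ball, and \<open>w\<close> is the sum
  of the \<open>U k\<close> divided by 4^(k+1). Applying M shifts the index by one at the cost of a
  factor 4D, so M w <= 4 D w almost everywhere, which gives A_1. The term with k = 0 is u/4, whence
  the majorization.\<close>

lemma rubio_de_francia:
  fixes r :: "real ^ 'n \<Rightarrow> real"
  assumes rB: "r \<in> classB" and u: "u \<in> modular_ball r"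
  obtains w where "w \<in> modular_ball r" "w \<in> A1" "AE x in lebesgue. u x \<le> 4 * w x"
proof -
  from rB have [measurable]: "r \<in> borel_measurable lebesgue" and r: "\<And>x. 1 \<le> r x"
    by (auto simp: classB_def)
  from classB_modular_ball[OF rB] obtain D :: real where D: "0 < D"
    and fin: "\<And>u. u \<in> modular_ball r \<Longrightarrow> AE x in lebesgue. hl_maximal u x < \<infinity>"
    and step: "\<And>u. u \<in> modular_ball r \<Longrightarrow> (\<lambda>x. enn2real (hl_maximal u x) / D) \<in> modular_ball r"
    by metis
  define U where "U k = ((\<lambda>v x. enn2real (hl_maximal v x) / D) ^^ k) u" for k
  have U: "U k \<in> modular_ball r" for k
    unfolding U_def by (induction k) (auto simp: u step)
  have U_Suc: "U (Suc k) x = enn2real (hl_maximal (U k) x) / D" for k x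
    by (simp add: U_def)
  note [measurable] = modular_ball_measurable[OF U]
  define V where "V = (\<lambda>x. \<Sum>k. ennreal (U k x / 4 ^ Suc k))"
  have V_eq: "V = (\<lambda>x. \<Sum>k. ennreal (1 / 4 ^ Suc k * U k x))"
    unfolding V_def times_divide_eq_left mult_1_left ..
  define w where "w = (\<lambda>x. enn2real (V x))"
  have V: "AE x in lebesgue. V x < \<infinity>" and w: "w \<in> modular_ball r"
    unfolding V_def w_def using modular_ball_suminf[of U r] U r by auto
  have "AE x in lebesgue. hl_maximal w x \<le> ennreal (4 * D * w x)"
  proof -
    \<comment> \<open>In \<open>U_Suc\<close>, \<open>enn2real\<close> recovers the maximal function
      only where it is finite, so finiteness is needed for all k at once.\<close>
    have "AE x in lebesgue. \<forall>k. hl_maximal (U k) x < \<infinity>"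
      using fin[OF U] by (simp add: AE_all_countable)
    with V show ?thesis
    proof eventually_elim
      case (elim x)
      have "hl_maximal w x \<le> (\<Sum>k. ennreal (1 / 4 ^ Suc k) * hl_maximal (U k) x)"
        unfolding w_def V_eq by (rule hl_maximal_suminf_le) (auto simp: modular_ball_nonneg[OF U])
      \<comment> \<open>M applied to \<open>U k\<close> is D times \<open>U (Suc k)\<close>, and
        1/4^(k+1) = 4/4^(k+2): the sum is 4D times the series \<open>V\<close> without its first
        term.\<close>
      also have "\<dots> = (\<Sum>k. ennreal (4 * D) * ennreal (U (Suc k) x / 4 ^ Suc (Suc k)))"
      proof (rule arg_cong[where f = suminf], rule ext)
        fix k
        obtain m where m: "hl_maximal (U k) x = ennreal m" "0 \<le> m"
          using elim(2)[rule_format, of k] by (cases "hl_maximal (U k) x") auto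
        with D show "ennreal (1 / 4 ^ Suc k) * hl_maximal (U k) x
            = ennreal (4 * D) * ennreal (U (Suc k) x / 4 ^ Suc (Suc k))"
          by (simp add: U_Suc ennreal_mult'[symmetric] power_Suc)
      qed
      also have "\<dots> = ennreal (4 * D) * (\<Sum>k. ennreal (U (Suc k) x / 4 ^ Suc (Suc k)))"
        by (rule ennreal_suminf_cmult)
      also have "\<dots> \<le> ennreal (4 * D) * V x"
        unfolding V_def by (intro mult_left_mono ennreal_suminf_Suc_le) simp
      also have "\<dots> = ennreal (4 * D * w x)"
        using elim D by (cases "V x") (auto simp: w_def ennreal_mult'[symmetric])
      finally show ?case .
    qed
  qed
  then have "w \<in> A1"
    using D weight_if_modular_ball[OF w _ r] by (intro A1_if_hl_maximal_le) auto
  moreover have "AE x in lebesgue. u x \<le> 4 * w x"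
    using V
  proof eventually_elim
    case (elim x)
    have "ennreal (u x / 4) \<le> V x"
      unfolding V_def using ennreal_le_suminf[of "\<lambda>k. ennreal (U k x / 4 ^ Suc k)" 0]
      by (simp add: U_def power_Suc)
    with elim show ?case by (cases "V x") (auto simp: w_def)
  qed
  ultimately show thesis using w that by blast
qed

text \<open>The weights 1/4^(k+1) collapse the sequence into one function of the ball, to which the
  iteration is applied once. The losses 4^(k+1) and 4 multiply to 4^(k+2).\<close>

lemma common_A1_majorant:
  fixes r :: "real ^ 'n \<Rightarrow> real"
  assumes rB: "r \<in> classB" and u: "\<And>k. u k \<in> modular_ball r"
  obtains w where "w \<in> modular_ball r" "w \<in> A1" "\<forall>k::nat. AE x in lebesgue. u k x \<le> 4 ^ (k + 2) * w x"
proof -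
  from rB have [measurable]: "r \<in> borel_measurable lebesgue" and r: "\<And>x. 1 \<le> r x"
    by (auto simp: classB_def)
  define V where "V = (\<lambda>x. \<Sum>k. ennreal (u k x / 4 ^ Suc k))"
  have V: "AE x in lebesgue. V x < \<infinity>" and v: "(\<lambda>x. enn2real (V x)) \<in> modular_ball r"
    unfolding V_def using modular_ball_suminf[of u r] u r by auto
  from rubio_de_francia[OF rB v] obtain w where w: "w \<in> modular_ball r" "w \<in> A1"
    and vw: "AE x in lebesgue. enn2real (V x) \<le> 4 * w x" by blast
  have "AE x in lebesgue. u k x \<le> 4 ^ (k + 2) * w x" for k
    using V vw
  proof eventually_elim
    case (elim x)
    have "ennreal (u k x / 4 ^ Suc k) \<le> V x"
      unfolding V_def by (rule ennreal_le_suminf)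
    with elim have "u k x / 4 ^ Suc k \<le> enn2real (V x)"
      by (cases "V x") auto
    also have "\<dots> \<le> 4 * w x" using elim by simp
    finally show ?case by (simp add: field_simps power_Suc)
  qed
  with w that show thesis by blast
qed

section \<open>Dilations of the modular and the norm\<close>

lemma epowr_divide_scale:
  assumes "0 < t" "0 < l"
  shows "(u / ennreal l) epowr a = ennreal (t powr a) * (u / ennreal (t * l)) epowr a"
  using assms by (cases u)
    (auto simp: divide_ennreal epowr_def ennreal_top_divide ennreal_mult'[symmetric] powr_mult[symmetric]
      ennreal_mult_top)

lemma modular_dilate_le:
  fixes p :: "real ^ 'n \<Rightarrow> real"
  assumes [measurable]: "p \<in> borel_measurable lebesgue" "f \<in> borel_measurable lebesgue"
    and p: "\<And>x. s \<le> p x" and t: "1 \<le> t" and l: "0 < l"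
  shows "modular p f (t * l) \<le> ennreal (t powr - s) * modular p f l"
proof -
  have "(f x / ennreal (t * l)) epowr p x \<le> ennreal (t powr - s) * (f x / ennreal l) epowr p x" for x
  proof -
    have "1 * (f x / ennreal (t * l)) epowr p x
        \<le> ennreal (t powr - s * t powr p x) * (f x / ennreal (t * l)) epowr p x"
    proof (rule mult_right_mono)
      have "1 \<le> t powr - s * t powr p x"
        using t p[of x] by (simp add: powr_add[symmetric] ge_one_powr_ge_zero)
      then show "1 \<le> ennreal (t powr - s * t powr p x)"
        by (simp flip: ennreal_1)
    qed simp
    also have "\<dots> = ennreal (t powr - s) * (f x / ennreal l) epowr p x"
      using t l epowr_divide_scale[of t l "f x" "p x"] by (simp add: ennreal_mult' mult.assoc)
    finally show ?thesis by simp
  qed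
  then have "modular p f (t * l) \<le> (\<integral>\<^sup>+x. ennreal (t powr - s) * (f x / ennreal l) epowr p x \<partial>lebesgue)"
    unfolding modular_def by (rule nn_integral_mono)
  also have "\<dots> = ennreal (t powr - s) * modular p f l"
    unfolding modular_def epowr_def by (rule nn_integral_cmult) measurable
  finally show ?thesis .
qed

text \<open>Converse to \<open>modular_dilate_le\<close>, resting on the upper bound of the
  exponent: t^p <= t^P for t >= 1. With t = 4 it compares the scales L/4 and L.\<close>

lemma modular_le_dilate:
  fixes p :: "real ^ 'n \<Rightarrow> real"
  assumes [measurable]: "p \<in> borel_measurable lebesgue" "f \<in> borel_measurable lebesgue"
    and p: "AE x in lebesgue. p x \<le> P" and t: "1 \<le> t" and l: "0 < l"
  shows "modular p f l \<le> ennreal (t powr P) * modular p f (t * l)"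
proof -
  have "AE x in lebesgue. (f x / ennreal l) epowr p x \<le> ennreal (t powr P) * (f x / ennreal (t * l)) epowr p x"
    using p
  proof eventually_elim
    case (elim x)
    then have "ennreal (t powr p x) \<le> ennreal (t powr P)"
      using t by (intro ennreal_leI powr_mono) auto
    then show ?case
      using t l by (subst epowr_divide_scale[of t]) (auto intro: mult_right_mono)
  qed
  then have "modular p f l \<le> (\<integral>\<^sup>+x. ennreal (t powr P) * (f x / ennreal (t * l)) epowr p x \<partial>lebesgue)"
    unfolding modular_def by (rule nn_integral_mono_AE)
  also have "\<dots> = ennreal (t powr P) * modular p f (t * l)"
    unfolding modular_def epowr_def by (rule nn_integral_cmult) measurable
  finally show ?thesis .
qed

text \<open>Membership only makes the modular finite at some scale; the infimum in the norm could
  still run over the empty set. Enlarging the scale brings the modular down to 1, because the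
  exponent stays above \<open>s > 0\<close>.\<close>

lemma vLp_norm_finite:
  fixes p :: "real ^ 'n \<Rightarrow> real"
  assumes [measurable]: "p \<in> borel_measurable lebesgue" and f: "f \<in> vLp p"
    and p: "\<And>x. s \<le> p x" and s: "0 < s"
  shows "vLp_norm p f < \<infinity>"
proof -
  from f have [measurable]: "f \<in> borel_measurable lebesgue" by (simp add: vLp_def)
  from f obtain l where l: "0 < l" "modular p f l < \<infinity>"
    by (auto simp: vLp_def)
  then obtain m where m: "modular p f l = ennreal m" "0 \<le> m"
    by (cases "modular p f l") auto
  \<comment> \<open>Here t^s = max 1 m, so the dilation divides the bound \<open>m\<close> by max 1
    m.\<close>
  define t where "t = (max 1 m) powr (1 / s)"
  have t: "1 \<le> t" using s by (simp add: t_def ge_one_powr_ge_zero)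
  have "modular p f (t * l) \<le> ennreal (t powr - s) * modular p f l"
    using p t l by (intro modular_dilate_le) auto
  also have "\<dots> = ennreal (m / max 1 m)"
    using s m by (simp add: t_def powr_powr ennreal_mult'[symmetric] powr_minus divide_inverse mult.commute)
  also have "\<dots> \<le> 1"
    by (simp flip: ennreal_1)
  finally have "modular p f (t * l) \<le> 1" .
  then have "vLp_norm p f \<le> ennreal (t * l)"
    unfolding vLp_norm_def using f t l by (auto intro!: Inf_lower exI[of _ "t * l"])
  then show ?thesis by (auto intro: le_less_trans)
qed

lemma modular_le_one_if_norm_less:
  assumes "vLp_norm p f < ennreal l"
  obtains m where "0 < m" "m < l" "modular p f m \<le> 1"
proof -
  from assms obtain m where "0 < m" "modular p f m \<le> 1" "ennreal m < ennreal l"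
    by (auto simp: vLp_norm_def Inf_less_iff split: if_splits)
  then show thesis using that by (simp add: ennreal_less_iff)
qed

lemma modular_antimono:
  assumes "\<And>x. 0 < p x" "0 < l" "l \<le> m"
  shows "modular p f m \<le> modular p f l"
  unfolding modular_def
proof (intro nn_integral_mono epowr_mono assms)
  fix x
  show "f x / ennreal m \<le> f x / ennreal l"
    using assms by (cases "f x")
      (auto simp: divide_ennreal ennreal_top_divide intro!: ennreal_leI divide_left_mono)
qed

text \<open>With a the norm of \<open>f\<close>, L = 2a lies above the norm and L/4 = a/2 below it,
  so neither bound on the modular of \<open>f\<close> asks whether the infimum is attained. The norm
  of \<open>g\<close> is below a/C, which leaves a scale m < a/C for \<open>g\<close>.\<close>

lemma vLp_norm_not_le:
  fixes p :: "real ^ 'n \<Rightarrow> real"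
  assumes [measurable]: "p \<in> borel_measurable lebesgue" and f: "f \<in> vLp p"
    and p: "\<And>x. s \<le> p x" and s: "0 < s" and C: "0 < C"
    and not_le: "\<not> vLp_norm p f \<le> ennreal C * vLp_norm p g"
  obtains L m where "0 < L" "modular p f L \<le> 1" "1 < modular p f (L / 4)"
    "0 < m" "modular p g m \<le> 1" "C * m \<le> L"
proof -
  have p0: "0 < p x" for x using p[of x] s by simp
  from vLp_norm_finite[OF assms(1-4)] obtain a where a: "vLp_norm p f = ennreal a" "0 \<le> a"
    by (cases "vLp_norm p f") auto
  with not_le have less: "ennreal C * vLp_norm p g < ennreal a" by simp
  then have a0: "0 < a" by (cases "a = 0") (use a in auto)
  have "vLp_norm p g \<noteq> \<infinity>"
    using less C by (auto simp: ennreal_mult_top)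
  then obtain b where b: "vLp_norm p g = ennreal b" "0 \<le> b"
    by (cases "vLp_norm p g") auto
  with less C have "b < a / C"
    by (simp add: ennreal_mult'[symmetric] ennreal_less_iff field_simps)
  with b have "vLp_norm p g < ennreal (a / C)"
    by (simp add: ennreal_less_iff)
  then obtain m where m: "0 < m" "m < a / C" "modular p g m \<le> 1"
    by (rule modular_le_one_if_norm_less)
  have "vLp_norm p f < ennreal (2 * a)"
    using a a0 by (simp add: ennreal_less_iff)
  then obtain l where l: "0 < l" "l < 2 * a" "modular p f l \<le> 1"
    by (rule modular_le_one_if_norm_less)
  have "modular p f (2 * a) \<le> 1"
    using modular_antimono[of p l "2 * a" f] p0 l by simp
  moreover have "1 < modular p f (2 * a / 4)"
  proof (rule ccontr)
    assume "\<not> ?thesis"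
    then have "vLp_norm p f \<le> ennreal (2 * a / 4)"
      unfolding vLp_norm_def using f a0 by (auto intro!: Inf_lower exI[of _ "2 * a / 4"])
    then show False using a a0 by simp
  qed
  moreover have "C * m \<le> 2 * a"
    using m C a0 by (simp add: field_simps)
  ultimately show thesis using that[of "2 * a" m] a0 m by simp
qed

section \<open>Young's inequality and the transfer from weighted integrals to modulars\<close>

text \<open>Young's inequality with both constants 1, by cases. If b^d <= a^(p-s), the product is at
  most a^p; otherwise a^s is at most b^(d s/(p-s)), and the exponents of b add up to d
  p/(p-s).\<close>

lemma powr_mult_powr_le_add:
  assumes b: "0 \<le> b" and s: "0 < s" "s < p"
  shows "a epowr s * ennreal (b powr d) \<le> a epowr p + ennreal (b powr (d * p / (p - s)))"
proof (cases a)
  case (real \<alpha>)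
  have "\<alpha> powr s * b powr d \<le> \<alpha> powr p + b powr (d * p / (p - s))"
  proof (cases "b powr d \<le> \<alpha> powr (p - s)")
    case True
    then have "\<alpha> powr s * b powr d \<le> \<alpha> powr s * \<alpha> powr (p - s)"
      by (intro mult_left_mono) auto
    also have "\<dots> = \<alpha> powr p" by (simp flip: powr_add)
    finally show ?thesis by (simp add: add_increasing2)
  next
    case False
    then have "(\<alpha> powr (p - s)) powr (s / (p - s)) \<le> (b powr d) powr (s / (p - s))"
      using s by (intro powr_mono2) auto
    then have "\<alpha> powr s \<le> b powr (d * s / (p - s))"
      using s by (simp add: powr_powr)
    then have "\<alpha> powr s * b powr d \<le> b powr (d * s / (p - s)) * b powr d"
      by (intro mult_right_mono) auto
    also have "\<dots> = b powr (d * p / (p - s))"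
      unfolding powr_add[symmetric] using s by (intro arg_cong[where f = "(powr) b"]) (simp add: field_simps)
    finally show ?thesis by (simp add: add_increasing)
  qed
  with real show ?thesis
    by (simp add: epowr_ennreal ennreal_mult'[symmetric] ennreal_plus[symmetric] ennreal_leI del: ennreal_plus)
qed (simp add: epowr_def)

text \<open>Young's inequality for h/l and w leaves two modulars, each at most 1. The estimate
  serves twice: for f it gives the finiteness under which the weighted inequality is assumed, for g
  it bounds the right side.\<close>

lemma weighted_integral_le:
  fixes p w :: "real ^ 'n \<Rightarrow> real"
  assumes [measurable]: "p \<in> borel_measurable lebesgue" "h \<in> borel_measurable lebesgue"
    and s: "0 < s" "\<And>x. s < p x" and l: "0 < l"
    and w: "w \<in> modular_ball (\<lambda>x. d * p x / (p x - s))" and h: "modular p h l \<le> 1"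
  shows "(\<integral>\<^sup>+x. h x epowr s * ennreal (w x powr d) \<partial>lebesgue) \<le> ennreal (2 * l powr s)"
proof -
  note [measurable] = modular_ball_measurable[OF w]
  have [measurable]: "(\<lambda>x. (h x / ennreal l) epowr p x) \<in> borel_measurable lebesgue"
    unfolding epowr_def by measurable
  have "h x epowr s * ennreal (w x powr d)
      \<le> ennreal (l powr s) * ((h x / ennreal l) epowr p x + ennreal (w x powr (d * p x / (p x - s))))" for x
  proof -
    have "h x epowr s * ennreal (w x powr d) = ennreal (l powr s) * ((h x / ennreal l) epowr s * ennreal (w x powr d))"
      using epowr_divide_scale[of l 1 "h x" s] l by (simp add: mult.assoc divide_ennreal_def)
    then show ?thesis
      using powr_mult_powr_le_add[of "w x" s "p x" "h x / ennreal l" d] s modular_ball_nonneg[OF w]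
      by (auto intro: mult_left_mono)
  qed
  then have "(\<integral>\<^sup>+x. h x epowr s * ennreal (w x powr d) \<partial>lebesgue)
      \<le> (\<integral>\<^sup>+x. ennreal (l powr s) * ((h x / ennreal l) epowr p x + ennreal (w x powr (d * p x / (p x - s)))) \<partial>lebesgue)"
    by (rule nn_integral_mono)
  also have "\<dots> = ennreal (l powr s) * (modular p h l + (\<integral>\<^sup>+x. ennreal (w x powr (d * p x / (p x - s))) \<partial>lebesgue))"
    unfolding modular_def by (subst nn_integral_cmult) (auto simp: nn_integral_add)
  also have "\<dots> \<le> ennreal (l powr s) * (1 + 1)"
    using h modular_ball_integral[OF w] by (intro mult_left_mono add_mono) auto
  also have "\<dots> = ennreal (2 * l powr s)"
    by (simp add: ennreal_mult' mult.commute)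
  finally show ?thesis .
qed

text \<open>With u = (f/L)^((p-s)/d) one has (f/L)^p = (f/L)^s u^d, and \<open>dual\<close> bounds u
  by B w; this leaves a multiple of the weighted integral of f^s. After passing to g, the bound 2
  m^s combines with L^(-s) into (m/L)^s.\<close>

lemma modular_le_of_weighted_inequality:
  fixes p w :: "real ^ 'n \<Rightarrow> real"
  assumes [measurable]: "p \<in> borel_measurable lebesgue" "f \<in> borel_measurable lebesgue"
      "g \<in> borel_measurable lebesgue"
    and s: "0 < s" "\<And>x. s < p x" and d: "0 < d" and K: "0 \<le> K" and B: "0 \<le> B"
    and w: "w \<in> modular_ball (\<lambda>x. d * p x / (p x - s))"
    and L: "0 < L" "modular p f L \<le> 1" and m: "0 < m" "modular p g m \<le> 1"
    and ineq: "(\<integral>\<^sup>+x. f x epowr s * ennreal (w x powr d) \<partial>lebesgue) < \<infinity> \<Longrightarrow>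
      (\<integral>\<^sup>+x. f x epowr s * ennreal (w x powr d) \<partial>lebesgue)
        \<le> ennreal K * (\<integral>\<^sup>+x. g x epowr s * ennreal (w x powr d) \<partial>lebesgue)"
    and dual: "AE x in lebesgue. enn2real (f x / ennreal L) powr ((p x - s) / d) \<le> B * w x"
  shows "modular p f L \<le> ennreal (2 * K * B powr d * (m / L) powr s)"
proof -
  note [measurable] = modular_ball_measurable[OF w]
  have w0: "0 \<le> w x" for x using w by (rule modular_ball_nonneg)
  have [measurable]: "(\<lambda>x. (f x / ennreal L) epowr p x) \<in> borel_measurable lebesgue"
    unfolding epowr_def by measurable
  let ?I = "\<lambda>h. \<integral>\<^sup>+x. h x epowr s * ennreal (w x powr d) \<partial>lebesgue"
  \<comment> \<open>\<open>enn2real\<close> vanishes where \<open>f\<close> is infinite, so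
    \<open>dual\<close> says nothing there; such points form a null set.\<close>
  have "AE x in lebesgue. (f x / ennreal L) epowr p x \<noteq> \<infinity>"
    using L by (intro nn_integral_PInf_AE) (auto simp: modular_def top_unique)
  then have "AE x in lebesgue. (f x / ennreal L) epowr p x
      \<le> ennreal (B powr d * L powr - s) * (f x epowr s * ennreal (w x powr d))"
    using dual
  proof eventually_elim
    case (elim x)
    then obtain v where v: "f x = ennreal v" "0 \<le> v"
      using L by (cases "f x") (auto simp: epowr_def ennreal_top_divide)
    let ?u = "v / L"
    have "?u powr p x = ?u powr s * (?u powr ((p x - s) / d)) powr d"
      using d by (simp add: powr_powr flip: powr_add)
    also have "\<dots> \<le> ?u powr s * (B * w x) powr d"
      using elim v L d by (intro mult_left_mono powr_mono2) (auto simp: divide_ennreal)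
    also have "\<dots> = (B powr d * L powr - s) * (v powr s * w x powr d)"
      using v L B w0 by (simp add: powr_divide powr_mult powr_minus field_simps)
    finally show ?case
      using v L by (simp add: divide_ennreal epowr_ennreal ennreal_mult'[symmetric] ennreal_leI)
  qed
  then have "modular p f L \<le> (\<integral>\<^sup>+x. ennreal (B powr d * L powr - s) * (f x epowr s * ennreal (w x powr d)) \<partial>lebesgue)"
    unfolding modular_def by (rule nn_integral_mono_AE)
  also have "\<dots> = ennreal (B powr d * L powr - s) * ?I f"
    unfolding epowr_def by (rule nn_integral_cmult) measurable
  also have "\<dots> \<le> ennreal (B powr d * L powr - s) * (ennreal K * ?I g)"
  proof (rule mult_left_mono)
    have "?I f \<le> ennreal (2 * L powr s)"
      using s w L by (intro weighted_integral_le) auto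
    then show "?I f \<le> ennreal K * ?I g"
      by (intro ineq) (auto intro: le_less_trans)
  qed simp
  also have "\<dots> \<le> ennreal (B powr d * L powr - s) * (ennreal K * ennreal (2 * m powr s))"
    using s w m by (intro mult_left_mono weighted_integral_le) auto
  also have "\<dots> = ennreal (2 * K * B powr d * (m / L) powr s)"
  proof -
    have "(m / L) powr s = m powr s * L powr - s"
      using L m by (simp add: powr_divide powr_minus_divide)
    then show ?thesis
      using K by (simp add: ennreal_mult'[symmetric] ac_simps)
  qed
  finally show ?thesis .
qed

section \<open>The contradiction from a sequence of violating pairs\<close>

lemma not_bounded_below_by_halving:
  fixes K :: real
  assumes "\<And>k::nat. 1 < K / 2 ^ k"
  shows False
proof -
  obtain k :: nat where "K < 2 ^ k" using real_arch_pow[of 2 K] by auto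
  then have "K / 2 ^ k < 1" by simp
  with assms[of k] show False by simp
qed

theorem theorem1p3:
  fixes \<F> :: "((real ^ 'n \<Rightarrow> ennreal) \<times> (real ^ 'n \<Rightarrow> ennreal)) set"
    and p :: "real ^ 'n \<Rightarrow> real"
    and p0 \<delta> :: real
    and C0 :: "real \<Rightarrow> real"
  assumes "\<And>f g. (f, g) \<in> \<F> \<Longrightarrow> f \<in> borel_measurable lebesgue \<and> g \<in> borel_measurable lebesgue"
    and "0 < p0" and "0 < \<delta>" and "\<delta> < 1"
    and "\<And>t. 0 < C0 t"
    and "\<And>w f g. w \<in> A1 \<Longrightarrow> (f, g) \<in> \<F> \<Longrightarrow>
           (\<integral>\<^sup>+x. f x epowr p0 * ennreal (w x powr \<delta>) \<partial>lebesgue) < \<infinity> \<Longrightarrow>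
           (\<integral>\<^sup>+x. f x epowr p0 * ennreal (w x powr \<delta>) \<partial>lebesgue)
             \<le> ennreal (C0 (A1_const w)) * (\<integral>\<^sup>+x. g x epowr p0 * ennreal (w x powr \<delta>) \<partial>lebesgue)"
    and "p \<in> borel_measurable lebesgue" and "\<And>x. 0 < p x"
    and "ereal p0 < exponent_minus p" and "exponent_plus p < ereal (p0 / (1 - \<delta>))"
    and "(\<lambda>x. \<delta> * conj_exponent (\<lambda>y. p y / p0) x) \<in> classB"
  shows "\<exists>C>0. \<forall>(f, g) \<in> \<F>. f \<in> vLp_quasi p \<longrightarrow>
           vLp_quasi_norm p f \<le> ennreal C * vLp_quasi_norm p g"
proof (rule ccontr)
  assume contra: "\<not> ?thesis"
  \<comment> \<open>\<open>p0\<close> is an admissible auxiliary exponent, so the one picked by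
    \<open>SOME\<close> has its defining property.\<close>
  have s0: "0 < vLp_aux p"
    unfolding vLp_aux_def
    using someI[of "\<lambda>s. 0 < s \<and> ereal s < exponent_minus p" p0] assms(2,9) by blast
  have quasi: "h \<in> vLp_quasi p \<longleftrightarrow> h \<in> vLp p" "vLp_quasi_norm p h = vLp_norm p h"
    if "h \<in> borel_measurable lebesgue" for h
    using quasi_space_indep[OF assms(8) s0 that] quasi_norm_indep[OF assms(8) s0 that] that
    by (simp_all add: vLp_quasi_def vLp_quasi_norm_def Let_def)
  define r where "r = (\<lambda>x. \<delta> * p x / (p x - p0))"
  \<comment> \<open>Where p = p0 both sides are divisions by zero and equal 0.\<close>
  have "(\<lambda>x. \<delta> * conj_exponent (\<lambda>y. p y / p0) x) = r"
  proof
    fix x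
    show "\<delta> * conj_exponent (\<lambda>y. p y / p0) x = r x"
      using assms(8)[of x] assms(2) by (simp add: r_def conj_exponent_def divide_simps)
  qed
  with assms(11) have rB: "r \<in> classB" by simp
  then have r1: "1 \<le> r x" for x by (simp add: classB_def)
  \<comment> \<open>\<open>classB\<close> demands 1 <= r at every point, so p > p0 holds everywhere;
    the essential infimum would give it almost everywhere.\<close>
  have p: "p0 < p x" for x
  proof (rule ccontr)
    assume "\<not> ?thesis"
    then have "r x \<le> 0"
      using assms(3) assms(8)[of x] by (auto simp: r_def divide_le_0_iff)
    with r1[of x] show False by simp
  qed
  define P where "P = p0 / (1 - \<delta>)"
  have P: "AE x in lebesgue. p x \<le> P"
    using esssup_AE[of "\<lambda>x. ereal (p x)" lebesgue]
  proof eventually_elim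
    case (elim x)
    from le_less_trans[OF this assms(10)[unfolded exponent_plus_def]] have "ereal (p x) < ereal P"
      by (simp add: P_def)
    then show ?case by simp
  qed
  \<comment> \<open>The p0-th power 8^k outruns the loss 4^(k+2) of the common majorant.\<close>
  define c where "c k = (8 ^ k) powr (1 / p0)" for k :: nat
  have c: "0 < c k" "c k powr p0 = 8 ^ k" for k
    using assms(2) by (simp_all add: c_def powr_powr)
  have "\<exists>f g L m. (f, g) \<in> \<F> \<and> 0 < L \<and> modular p f L \<le> 1 \<and> 1 < modular p f (L / 4)
      \<and> 0 < m \<and> modular p g m \<le> 1 \<and> c k * m \<le> L" for k
  proof -
    from contra c(1)[of k] obtain f g where fg: "(f, g) \<in> \<F>" "f \<in> vLp_quasi p"
        "\<not> vLp_quasi_norm p f \<le> ennreal (c k) * vLp_quasi_norm p g"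
      by fastforce
    then have "f \<in> vLp p" "\<not> vLp_norm p f \<le> ennreal (c k) * vLp_norm p g"
      using assms(1)[OF fg(1)] quasi by auto
    from vLp_norm_not_le[OF assms(7) this(1) less_imp_le[OF p] assms(2) c(1) this(2)] fg(1)
    show ?thesis by metis
  qed
  then obtain f g L m where fg: "\<And>k. (f k, g k) \<in> \<F>"
    and L: "\<And>k. 0 < L k" "\<And>k. modular p (f k) (L k) \<le> 1" "\<And>k. 1 < modular p (f k) (L k / 4)"
    and m: "\<And>k. 0 < m k" "\<And>k. modular p (g k) (m k) \<le> 1" "\<And>k. c k * m k \<le> L k"
    by metis
  note [measurable] = assms(7)
  have [measurable]: "f k \<in> borel_measurable lebesgue" "g k \<in> borel_measurable lebesgue" for k
    using assms(1)[OF fg] by auto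
  define u where "u k x = enn2real (f k x / ennreal (L k)) powr ((p x - p0) / \<delta>)" for k x
  \<comment> \<open>The exponents (p - p0)/\<delta> and r multiply to p, so the modular of
    \<open>u k\<close> is controlled by that of \<open>f k\<close> at scale
    \<open>L k\<close>.\<close>
  have u: "u k \<in> modular_ball r" for k
  proof -
    have "ennreal (u k x powr r x) \<le> (f k x / ennreal (L k)) epowr p x" for x
      using p[of x] assms(3) by (simp add: u_def r_def powr_powr epowr_def)
    then have "(\<integral>\<^sup>+x. ennreal (u k x powr r x) \<partial>lebesgue) \<le> modular p (f k) (L k)"
      unfolding modular_def by (rule nn_integral_mono)
    with L(2)[of k] have "(\<integral>\<^sup>+x. ennreal (u k x powr r x) \<partial>lebesgue) \<le> 1"
      by (rule order_trans[rotated])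
    moreover have "u k \<in> borel_measurable lebesgue"
      unfolding u_def by measurable
    ultimately show ?thesis by (simp add: modular_ball_def u_def)
  qed
  obtain w where w: "w \<in> modular_ball r" "w \<in> A1"
    and uw: "\<forall>k::nat. AE x in lebesgue. u k x \<le> 4 ^ (k + 2) * w x"
    by (rule common_A1_majorant[of r u, OF rB u])
  \<comment> \<open>\<open>w\<close> is chosen before k, so \<open>K\<close> is one number even if
    \<open>C0\<close> is unbounded.\<close>
  define K where "K = C0 (A1_const w)"
  have K: "0 < K" using assms(5) by (simp add: K_def)
  \<comment> \<open>32 = 2 * 4^2, with 2 from Young's inequality and 4^2 from 4^(k+2). The factor
    4^P is the price of moving from scale L/4, where the modular exceeds 1, to scale L.\<close>
  have "1 < 4 powr P * (32 * K) / 2 ^ k" for k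
  proof -
    have "modular p (f k) (L k) \<le> ennreal (2 * K * (4 ^ (k + 2)) powr \<delta> * (m k / L k) powr p0)"
    proof (rule modular_le_of_weighted_inequality)
      show "w \<in> modular_ball (\<lambda>x. \<delta> * p x / (p x - p0))"
        using w(1) by (simp only: r_def)
      show "AE x in lebesgue. enn2real (f k x / ennreal (L k)) powr ((p x - p0) / \<delta>) \<le> 4 ^ (k + 2) * w x"
        using uw[rule_format, of k] by (simp only: u_def)
    qed (use assms(2,3) p K L m assms(6)[OF w(2) fg[of k]] in \<open>simp_all add: K_def\<close>)
    \<comment> \<open>As \<delta> < 1, the power \<delta> of 4^(k+2) is at most 4^(k+2) itself; m/L
      <= 1/c gives 1/8^k.\<close>
    also have "\<dots> \<le> ennreal (2 * K * 4 ^ (k + 2) * (1 / 8 ^ k))"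
    proof (intro ennreal_leI mult_mono)
      show "(4 ^ (k + 2)) powr \<delta> \<le> (4 ^ (k + 2) :: real)"
        using powr_mono[of \<delta> 1 "4 ^ (k + 2) :: real"] assms(4) by simp
      have "m k / L k \<le> 1 / c k"
        using m(3)[of k] L(1)[of k] c(1)[of k] by (simp add: field_simps)
      then have "(m k / L k) powr p0 \<le> (1 / c k) powr p0"
        using assms(2) m(1)[of k] L(1)[of k] by (intro powr_mono2) auto
      then show "(m k / L k) powr p0 \<le> 1 / 8 ^ k"
        using c[of k] by (simp add: powr_divide)
    qed (use K in auto)
    also have "2 * K * 4 ^ (k + 2) * (1 / 8 ^ k) = 32 * K / 2 ^ k"
      using power_mult_distrib[of "2::real" 4 k] by (simp add: power_add power_Suc field_simps)
    finally have "modular p (f k) (L k) \<le> ennreal (32 * K / 2 ^ k)" .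
    have "1 < modular p (f k) (L k / 4)" by (rule L(3))
    also have "\<dots> \<le> ennreal (4 powr P) * modular p (f k) (4 * (L k / 4))"
      using P L(1)[of k] by (intro modular_le_dilate) auto
    also have "\<dots> \<le> ennreal (4 powr P) * ennreal (32 * K / 2 ^ k)"
      using \<open>modular p (f k) (L k) \<le> ennreal (32 * K / 2 ^ k)\<close> by (simp add: mult_left_mono)
    also have "\<dots> = ennreal (4 powr P * (32 * K) / 2 ^ k)"
      using K by (simp add: ennreal_mult'[symmetric])
    finally show ?thesis
      by (simp add: ennreal_less_iff flip: ennreal_1)
  qed
  then show False by (rule not_bounded_below_by_halving)
qed

end
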